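(* Let $s\ge1$, $0<R<1/2$, $M>0$ and $1\le q\le\infty$. There exists a constant $C$ depending only on $R$ and $M$ such that for every integer $L>1$, with $h=1/L$ and $n=h^{-2}$, and every $u=\chi_\Omega\in\mathcal{F}_{s,R,M}$, the piecewise constant approximation by average values on each cell, $$\tilde u=\sum_{T\in\mathcal{T}_h}a_T(u)\,\chi_T,\qquad a_T(u)=\frac1{|T|}\int_T u,$$ satisfies $$\|\chi_\Omega-\tilde u\|_{L^q(D)}\le C h^{\frac1q}=C n^{-\frac1{2q}}.$$
   Context: $D=[0,1]^2$. For an integer $L>1$ and $h=1/L$, $\mathcal{T}_h=\{T_{i,j}=[(i-1)h,ih]\times[(j-1)h,jh] : i,j=1,\dots,L\}$, a grid of $n=L^2=h^{-2}$ cells. $\chi_A$ denotes the characteristic function of $A$. Convention: $1/\infty=0$. Class $\mathcal{F}_{s,R,M}$ ($s\ge1$, $0<R<1/2$, $M>0$): it consists of all characteristic functions $\chi_\Omega$ of domains $\Omega\subset[R,1-R]^2\subset D$ with the following property: for all $x\in D$ there exist an orthonormal system $(e_1,e_2)$ of $\mathbb{R}^2$ and a function $\psi\in\mathcal{C}^s([-R,R])$ with $\|\psi\|_{\mathcal{C}^s}\le M$ such that, for any $y=x+z_1e_1+z_2e_2$ with $|z_1|,|z_2|\le R$, one has $y\in\Omega\iff z_2\le\psi(z_1)$. Hölder norm: with $k_s:=\lceil s\rceil-1$ (equal to $\lfloor s\rfloor$ for non-integer $s$ and to $s-1$ for integer $s$), $$\|\psi\|_{\mathcal{C}^s}=\sup_{0\le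 k\le k_s}\|\psi^{(k)}\|_{L^\infty([-R,R])}+\sup_{a\ne b\in[-R,R]}\frac{|\psi^{(k_s)}(a)-\psi^{(k_s)}(b)|}{|a-b|^{s-k_s}}.$$ So for integer $s$, $\mathcal{C}^s$ denotes functions with Lipschitz derivatives up to order $s-1$. *)

theory Defs
  imports "HOL-Analysis.Analysis" "HOL-Probability.Essential_Supremum"
begin

definition unit_square :: "(real^2) set"
  where "unit_square = cbox 0 1"

definition grid :: "nat \<Rightarrow> (real^2) set set"
  where "grid L = (let h = 1 / real L in
    {cbox (vector [(real i - 1) * h, (real j - 1) * h]) (vector [real i * h, real j * h]) | i j.
       i \<in> {1..L} \<and> j \<in> {1..L}})"

definition cell_average :: "(real^2 \<Rightarrow> real) \<Rightarrow> (real^2) set \<Rightarrow> real"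
  where "cell_average u T = 1 / measure lebesgue T * (LINT x:T|lebesgue. u x)"

definition pc_approx :: "nat \<Rightarrow> (real^2 \<Rightarrow> real) \<Rightarrow> real^2 \<Rightarrow> real"
  where "pc_approx L u = (\<lambda>x. \<Sum>T\<in>grid L. cell_average u T * indicator T x)"

(* The exponent q ranges over [1, \<infinity>]. The norm takes values in [0, \<infinity>], and it is \<infinity> for
   functions that are not measurable (which esssup already ensures when q = \<infinity>), so an upper
   bound on it always includes measurability and finiteness of the integral. *)
definition Lq_norm :: "ennreal \<Rightarrow> 'a measure \<Rightarrow> ('a \<Rightarrow> real) \<Rightarrow> ennreal"
  where "Lq_norm q \<mu> f =
    (if q = \<infinity> then esssup \<mu> (\<lambda>x. ennreal \<bar>f x\<bar>)
     else let I = (\<integral>\<^sup>+x. ennreal (\<bar>f x\<bar> powr enn2real q) \<partial>\<mu>) in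
       if f \<notin> borel_measurable \<mu> \<or> I = \<infinity> then \<infinity>
       else ennreal (enn2real I powr (1 / enn2real q)))"

(* k-th derivative relative to S, hence one-sided at the end points of an interval *)
definition deriv_within :: "real set \<Rightarrow> nat \<Rightarrow> (real \<Rightarrow> real) \<Rightarrow> real \<Rightarrow> real"
  where "deriv_within S k \<psi> = ((\<lambda>g t. vector_derivative g (at t within S)) ^^ k) \<psi>"

definition holder_order :: "real \<Rightarrow> nat"
  where "holder_order s = nat (\<lceil>s\<rceil> - 1)"

definition holder_norm :: "real \<Rightarrow> real set \<Rightarrow> (real \<Rightarrow> real) \<Rightarrow> ennreal"
  where "holder_norm s S \<psi> = (let m = holder_order s in
    (SUP k\<in>{0..m}. Lq_norm \<infinity> (lebesgue_on S) (deriv_within S k \<psi>)) +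
    (SUP (a, b)\<in>{(a, b). a \<in> S \<and> b \<in> S \<and> a \<noteq> b}.
       ennreal (\<bar>deriv_within S m \<psi> a - deriv_within S m \<psi> b\<bar> / \<bar>a - b\<bar> powr (s - real m))))"

(* Only the values of the function on S matter. Continuity of the derivative of highest order
   follows from finiteness of the Hoelder quotient, since s - holder_order s > 0. *)
definition holder_space :: "real \<Rightarrow> real set \<Rightarrow> (real \<Rightarrow> real) set"
  where "holder_space s S =
    {\<psi>. (\<forall>k<holder_order s. deriv_within S k \<psi> differentiable_on S) \<and> holder_norm s S \<psi> < \<infinity>}"

definition orthonormal_system :: "real^2 \<Rightarrow> real^2 \<Rightarrow> bool"
  where "orthonormal_system e1 e2 \<longleftrightarrow> norm e1 = 1 \<and> norm e2 = 1 \<and> orthogonal e1 e2"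

(* No topological condition is imposed on \<Omega>: the local graph condition already forces
   \<Omega> to be closed. *)
definition char_class :: "real \<Rightarrow> real \<Rightarrow> real \<Rightarrow> (real^2 \<Rightarrow> real) set"
  where "char_class s R M = {indicator \<Omega> | \<Omega>.
    \<Omega> \<subseteq> cbox (vec R) (vec (1 - R)) \<and>
    (\<forall>x\<in>unit_square. \<exists>e1 e2 \<psi>. orthonormal_system e1 e2 \<and>
       \<psi> \<in> holder_space s {-R..R} \<and> holder_norm s {-R..R} \<psi> \<le> ennreal M \<and>
       (\<forall>z1 z2. \<bar>z1\<bar> \<le> R \<and> \<bar>z2\<bar> \<le> R \<longrightarrow>
          (x + z1 *\<^sub>R e1 + z2 *\<^sub>R e2 \<in> \<Omega> \<longleftrightarrow> z2 \<le> \<psi> z1)))}"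

end

theory Submission
  imports Defs
begin

text \<open>
  The error \<open>\<chi> - pc_approx\<close> has absolute value at most one almost everywhere, and it vanishes in the
  interior of every cell that lies inside the domain \<open>\<Omega>\<close> or outside it. So everything rests on the
  area covered by the mixed cells, those that meet both \<open>\<Omega>\<close> and its complement: if it is at most
  \<open>C * h\<close> with \<open>1 \<le> C\<close>, then the \<open>q\<close>-th power of the norm is at most \<open>C * h\<close>, hence the norm at most
  \<open>C * h powr (1 / q)\<close>, and for \<open>q = \<infinity>\<close> the norm is at most one
  (\<open>Lq_norm_le_of_small_support\<close>).

  That area is estimated by a covering argument. Whatever \<open>s \<ge> 1\<close> is, the bound on the Hoelder norm
  makes every local boundary function \<open>M\<close>-Lipschitz (\<open>holder_imp_lipschitz\<close>); this is the only trace
  of the regularity that is kept, and the reason why the constant does not depend on \<open>s\<close>. A finite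
  set \<open>F\<close>, chosen from \<open>R\<close> alone, has every point of the square within \<open>R / 4\<close> of one of its points.
  In the chart at such a point, a mixed cell of small diameter contains points on both sides of the
  graph of \<open>\<psi>\<close>, so by the Lipschitz bound each point of the cell is at height \<open>O(h)\<close> from the graph.
  The graph is sampled at \<open>L = 1 / h\<close> parameters, and one ball of radius \<open>O(h)\<close> around each sample
  suffices to catch all these points (\<open>mixed_points_cover\<close>). This makes \<open>card F * L\<close> balls of area
  \<open>O(h\<^sup>2)\<close>, of total area \<open>O(h)\<close>. Covering by balls makes the orientation of the charts irrelevant.
  When \<open>h\<close> is not small compared with \<open>R\<close>, the whole square, of area one, is already small enough.
\<close>

section \<open>Bounded Hoelder norm gives a Lipschitz bound\<close>

lemma holder_quotient_bound:
  assumes "holder_norm s S \<psi> \<le> ennreal M" "0 < M" "a \<in> S" "b \<in> S"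
  shows "\<bar>deriv_within S (holder_order s) \<psi> a - deriv_within S (holder_order s) \<psi> b\<bar>
    \<le> M * \<bar>a - b\<bar> powr (s - real (holder_order s))"
proof (cases "a = b")
  case False
  let ?q = "\<lambda>(a, b). ennreal (\<bar>deriv_within S (holder_order s) \<psi> a
    - deriv_within S (holder_order s) \<psi> b\<bar> / \<bar>a - b\<bar> powr (s - real (holder_order s)))"
  have "?q (a, b) \<le> (SUP p\<in>{(a, b). a \<in> S \<and> b \<in> S \<and> a \<noteq> b}. ?q p)"
    using assms False by (intro SUP_upper) auto
  also have "\<dots> \<le> holder_norm s S \<psi>"
    by (simp add: holder_norm_def Let_def)
  also note assms(1)
  finally have "\<bar>deriv_within S (holder_order s) \<psi> a - deriv_within S (holder_order s) \<psi> b\<bar>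
      / \<bar>a - b\<bar> powr (s - real (holder_order s)) \<le> M"
    using assms(2) by simp
  then show ?thesis
    using False by (simp add: divide_le_eq split: if_splits)
qed simp

lemma holder_derivative_bound_AE:
  assumes "holder_norm s S \<psi> \<le> ennreal M" "0 < M" "k \<le> holder_order s"
  shows "AE x in lebesgue_on S. \<bar>deriv_within S k \<psi> x\<bar> \<le> M"
proof -
  have "Lq_norm \<infinity> (lebesgue_on S) (deriv_within S k \<psi>)
      \<le> (SUP k\<in>{0..holder_order s}. Lq_norm \<infinity> (lebesgue_on S) (deriv_within S k \<psi>))"
    using assms(3) by (intro SUP_upper) auto
  also have "\<dots> \<le> holder_norm s S \<psi>"
    by (simp add: holder_norm_def Let_def)
  also note assms(1)
  finally have *: "esssup (lebesgue_on S) (\<lambda>x. ennreal \<bar>deriv_within S k \<psi> x\<bar>) \<le> ennreal M"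
    by (simp add: Lq_norm_def)
  show ?thesis
    using esssup_AE[of "\<lambda>x. ennreal \<bar>deriv_within S k \<psi> x\<bar>" "lebesgue_on S"]
  proof eventually_elim
    case (elim x)
    then have "ennreal \<bar>deriv_within S k \<psi> x\<bar> \<le> ennreal M" using * by order
    then show ?case using assms(2) by simp
  qed
qed

text \<open>For \<open>s = 1\<close> the bound is the Hoelder quotient itself. For \<open>s > 1\<close> it comes from the mean value
  theorem: the essential bound on \<open>\<psi>'\<close> holds at every interior point because \<open>\<psi>'\<close> is continuous.
  For \<open>s > 2\<close> that is so because \<open>\<psi>'\<close> is differentiable, and for \<open>1 < s \<le> 2\<close> because it is
  Hoelder continuous.\<close>

lemma holder_imp_lipschitz:
  assumes "1 \<le> s" "0 < R" "0 < M"
    and \<psi>: "\<psi> \<in> holder_space s {-R..R}" "holder_norm s {-R..R} \<psi> \<le> ennreal M"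
    and ab: "a \<in> {-R..R}" "b \<in> {-R..R}"
  shows "\<bar>\<psi> a - \<psi> b\<bar> \<le> M * \<bar>a - b\<bar>"
proof (cases "holder_order s = 0")
  case True
  with \<open>1 \<le> s\<close> have "s = 1"
    unfolding holder_order_def by linarith
  then show ?thesis
    using holder_quotient_bound[OF \<psi>(2) \<open>0 < M\<close> ab] True by (simp add: deriv_within_def)
next
  case False
  let ?S = "{-R..R}"
  define g where "g = deriv_within ?S 1 \<psi>"
  have g_eq: "g t = vector_derivative \<psi> (at t within ?S)" for t
    by (simp add: g_def deriv_within_def)
  have diff: "deriv_within ?S k \<psi> differentiable_on ?S" if "k < holder_order s" for k
    using \<psi>(1) that by (simp add: holder_space_def)
  have "continuous_on ?S g"
  proof (cases "holder_order s = 1")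
    case True
    with \<open>1 \<le> s\<close> have "1 < s"
      unfolding holder_order_def by linarith
    have q: "\<bar>g x - g y\<bar> \<le> M * \<bar>x - y\<bar> powr (s - 1)" if "x \<in> ?S" "y \<in> ?S" for x y
      using holder_quotient_bound[OF \<psi>(2) \<open>0 < M\<close> that] True by (simp add: g_def)
    show ?thesis
      unfolding continuous_on_def
    proof
      fix x assume x: "x \<in> ?S"
      have "((\<lambda>y. M * \<bar>y - x\<bar> powr (s - 1)) \<longlongrightarrow> M * 0) (at x within ?S)"
      proof (intro tendsto_mult tendsto_const)
        have "((\<lambda>y. \<bar>y - x\<bar>) \<longlongrightarrow> \<bar>x - x\<bar>) (at x within ?S)"
          by (intro tendsto_intros)
        then have "((\<lambda>y. \<bar>y - x\<bar> powr (s - 1)) \<longlongrightarrow> \<bar>x - x\<bar> powr (s - 1)) (at x within ?S)"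
          by (rule tendsto_powr'[OF _ tendsto_const]) (simp add: \<open>1 < s\<close>)
        then show "((\<lambda>y. \<bar>y - x\<bar> powr (s - 1)) \<longlongrightarrow> 0) (at x within ?S)" by simp
      qed
      then have lim: "((\<lambda>y. M * \<bar>y - x\<bar> powr (s - 1)) \<longlongrightarrow> 0) (at x within ?S)"
        by simp
      have "eventually (\<lambda>y. norm (g y - g x) \<le> M * \<bar>y - x\<bar> powr (s - 1)) (at x within ?S)"
        unfolding eventually_at using q[OF _ x] by (intro exI[of _ 1]) simp
      then have "((\<lambda>y. g y - g x) \<longlongrightarrow> 0) (at x within ?S)"
        using lim by (rule Lim_null_comparison)
      then show "(g \<longlongrightarrow> g x) (at x within ?S)"
        using LIM_zero_cancel by blast
    qed
  next
    case 2: False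
    then have "g differentiable_on ?S"
      unfolding g_def using False by (intro diff) simp
    then show ?thesis
      by (rule differentiable_imp_continuous_on)
  qed
  \<comment> \<open>The set where the bound holds is closed and has full measure in an open interval, hence it
    contains that interval.\<close>
  moreover have "AE x in lebesgue_on ?S. \<bar>g x\<bar> \<le> M"
    unfolding g_def using False by (intro holder_derivative_bound_AE[OF \<psi>(2) \<open>0 < M\<close>]) simp
  then have "AE x\<in>{-R<..<R} in lebesgue. x \<in> {x \<in> ?S. \<bar>g x\<bar> \<le> M}"
    by (subst (asm) AE_restrict_space_iff) auto
  moreover have "closed {x \<in> ?S. \<bar>g x\<bar> \<le> M}"
    using \<open>continuous_on ?S g\<close> by (intro continuous_on_closed_Collect_le continuous_intros) auto
  ultimately have bound: "\<bar>g x\<bar> \<le> M" if "x \<in> {-R<..<R}" for x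
    using mem_closed_if_AE_lebesgue_open[OF open_greaterThanLessThan _ _ that,
        where C = "{x \<in> ?S. \<bar>g x\<bar> \<le> M}"] by simp
  have "\<psi> differentiable_on ?S"
    using diff[of 0] False by (simp add: deriv_within_def)
  then have deriv: "(\<psi> has_vector_derivative g t) (at t within ?S)" if "t \<in> ?S" for t
    using that by (simp add: g_eq differentiable_on_def vector_derivative_works[symmetric])
  have "\<bar>\<psi> y - \<psi> x\<bar> \<le> M * \<bar>y - x\<bar>" if xy: "x \<in> ?S" "y \<in> ?S" "x < y" for x y
  proof -
    have cont: "continuous_on {x..y} \<psi>"
      using differentiable_imp_continuous_on[OF \<open>\<psi> differentiable_on ?S\<close>] xy
      by (auto elim: continuous_on_subset)
    have der: "(\<psi> has_derivative (\<lambda>h. h *\<^sub>R g t)) (at t)" if t: "x < t" "t < y" for t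
    proof -
      have "at t within ?S = at t"
        using xy t by (intro at_within_interior) (simp add: interior_atLeastAtMost_real)
      then show ?thesis
        using deriv[of t] t xy by (simp add: has_vector_derivative_def)
    qed
    obtain \<xi> where \<xi>: "x < \<xi>" "\<xi> < y" "\<psi> y - \<psi> x = (y - x) *\<^sub>R g \<xi>"
      using mvt[OF \<open>x < y\<close> cont der] by blast
    have "\<bar>\<psi> y - \<psi> x\<bar> = \<bar>g \<xi>\<bar> * \<bar>y - x\<bar>"
      using \<xi>(3) by (simp add: abs_mult)
    also have "\<dots> \<le> M * \<bar>y - x\<bar>"
      using \<xi>(1,2) xy by (intro mult_right_mono bound) auto
    finally show ?thesis .
  qed
  from this[of a b] this[of b a] show ?thesis
    using ab by (cases a b rule: linorder_cases) (auto simp: abs_minus_commute)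
qed

section \<open>Graph charts\<close>

text \<open>The condition that \<open>char_class\<close> imposes at a point, with the Hoelder bound on \<open>\<psi>\<close> weakened to
  the Lipschitz bound.\<close>

definition graph_chart ::
    "real \<Rightarrow> real \<Rightarrow> (real^2) set \<Rightarrow> real^2 \<Rightarrow> real^2 \<Rightarrow> real^2 \<Rightarrow> (real \<Rightarrow> real) \<Rightarrow> bool"
  where "graph_chart R M \<Omega> x e1 e2 \<psi> \<longleftrightarrow> orthonormal_system e1 e2 \<and>
    (\<forall>a\<in>{-R..R}. \<forall>b\<in>{-R..R}. \<bar>\<psi> a - \<psi> b\<bar> \<le> M * \<bar>a - b\<bar>) \<and>
    (\<forall>z1 z2. \<bar>z1\<bar> \<le> R \<and> \<bar>z2\<bar> \<le> R \<longrightarrow> (x + z1 *\<^sub>R e1 + z2 *\<^sub>R e2 \<in> \<Omega> \<longleftrightarrow> z2 \<le> \<psi> z1))"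

lemma char_class_graph_chart:
  assumes "1 \<le> s" "0 < R" "0 < M" "indicator \<Omega> \<in> char_class s R M"
  shows "\<Omega> \<subseteq> unit_square" "x \<in> unit_square \<Longrightarrow> \<exists>e1 e2 \<psi>. graph_chart R M \<Omega> x e1 e2 \<psi>"
proof -
  obtain \<Omega>' where "(indicator \<Omega> :: _ \<Rightarrow> real) = indicator \<Omega>'"
    and \<Omega>': "\<Omega>' \<subseteq> cbox (vec R) (vec (1 - R))"
    "\<forall>x\<in>unit_square. \<exists>e1 e2 \<psi>. orthonormal_system e1 e2 \<and>
       \<psi> \<in> holder_space s {-R..R} \<and> holder_norm s {-R..R} \<psi> \<le> ennreal M \<and>
       (\<forall>z1 z2. \<bar>z1\<bar> \<le> R \<and> \<bar>z2\<bar> \<le> R \<longrightarrow>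
          (x + z1 *\<^sub>R e1 + z2 *\<^sub>R e2 \<in> \<Omega>' \<longleftrightarrow> z2 \<le> \<psi> z1))"
    using assms(4) by (auto simp: char_class_def)
  then have "\<Omega> = \<Omega>'"
    by (metis indicator_eq_1_iff subsetI subset_antisym)
  have "cbox (vec R) (vec (1 - R)) \<subseteq> unit_square"
  proof
    fix x :: "real^2" assume "x \<in> cbox (vec R) (vec (1 - R))"
    then have "R \<le> x $ i" "x $ i \<le> 1 - R" for i
      by (auto simp: mem_box_cart)
    with \<open>0 < R\<close> have "0 \<le> x $ i" "x $ i \<le> 1" for i
      by (smt (verit))+
    then show "x \<in> unit_square"
      by (simp add: unit_square_def mem_box_cart)
  qed
  with \<Omega>'(1) show "\<Omega> \<subseteq> unit_square"
    by (simp add: \<open>\<Omega> = \<Omega>'\<close>)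
  assume "x \<in> unit_square"
  with \<Omega>'(2) show "\<exists>e1 e2 \<psi>. graph_chart R M \<Omega> x e1 e2 \<psi>"
    unfolding graph_chart_def \<open>\<Omega> = \<Omega>'\<close> using holder_imp_lipschitz[OF assms(1-3)] by meson
qed

lemma orthonormal_system_expand:
  fixes x :: "real^2"
  assumes "orthonormal_system e1 e2"
  shows "(x \<bullet> e1) *\<^sub>R e1 + (x \<bullet> e2) *\<^sub>R e2 = x"
proof -
  have *: "norm e1 = 1" "norm e2 = 1" "e1 \<bullet> e2 = 0"
    using assms by (auto simp: orthonormal_system_def orthogonal_def)
  then have "e1 \<noteq> e2" by (metis norm_eq_1 zero_neq_one)
  have orth: "pairwise orthogonal {e1, e2}"
    using * by (auto simp: pairwise_def orthogonal_def inner_commute)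
  have "independent {e1, e2}"
    by (rule pairwise_orthogonal_independent[OF orth]) (use * in auto)
  then have "UNIV \<subseteq> span {e1, e2}"
    by (rule card_ge_dim_independent[rotated]) (auto simp: \<open>e1 \<noteq> e2\<close>)
  then have "(\<Sum>i\<in>{e1, e2}. (x \<bullet> i) *\<^sub>R i) = x"
    using * by (intro orthonormal_basis_expand[OF orth]) auto
  then show ?thesis
    using \<open>e1 \<noteq> e2\<close> by simp
qed

lemma abs_inner_unit_le: "norm e = 1 \<Longrightarrow> \<bar>x \<bullet> e\<bar> \<le> norm x"
  using Cauchy_Schwarz_ineq2[of x e] by simp

text \<open>Read off at a point given by its position rather than its coordinates: these are bounded by
  the distance, so a disc of radius \<open>R\<close> lies in the coordinate square of the chart.\<close>

lemma graph_chart_mem_iff: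
  assumes "graph_chart R M \<Omega> x e1 e2 \<psi>" "dist x y \<le> R"
  shows "y \<in> \<Omega> \<longleftrightarrow> (y - x) \<bullet> e2 \<le> \<psi> ((y - x) \<bullet> e1)"
proof -
  have on: "orthonormal_system e1 e2"
    using assms(1) by (simp add: graph_chart_def)
  have "\<bar>(y - x) \<bullet> e1\<bar> \<le> R" "\<bar>(y - x) \<bullet> e2\<bar> \<le> R"
    using on abs_inner_unit_le[of e1 "y - x"] abs_inner_unit_le[of e2 "y - x"] assms(2)
    by (auto simp: orthonormal_system_def dist_norm norm_minus_commute)
  moreover have "x + ((y - x) \<bullet> e1) *\<^sub>R e1 + ((y - x) \<bullet> e2) *\<^sub>R e2 = y"
    using orthonormal_system_expand[OF on, of "y - x"] by (simp add: add.assoc)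
  ultimately show ?thesis
    using assms(1) unfolding graph_chart_def by metis
qed

text \<open>Moving by \<open>\<delta>\<close> changes each coordinate by at most \<open>\<delta>\<close>, hence changes
  \<open>z2 - \<psi> z1\<close>, whose sign decides membership, by at most \<open>(M + 1) * \<delta>\<close>.\<close>

lemma graph_chart_height_diff:
  assumes "graph_chart R M \<Omega> x e1 e2 \<psi>" "0 < M" "dist x y \<le> R" "dist x w \<le> R"
  shows "\<bar>((y - x) \<bullet> e2 - \<psi> ((y - x) \<bullet> e1)) - ((w - x) \<bullet> e2 - \<psi> ((w - x) \<bullet> e1))\<bar>
    \<le> (M + 1) * dist y w"
proof -
  have e: "norm e1 = 1" "norm e2 = 1"
    using assms(1) by (auto simp: graph_chart_def orthonormal_system_def)
  have "\<bar>(v - x) \<bullet> e1\<bar> \<le> R" if "dist x v \<le> R" for v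
    using that abs_inner_unit_le[OF e(1), of "v - x"] by (simp add: dist_norm norm_minus_commute)
  from this[of y] this[of w] have "(y - x) \<bullet> e1 \<in> {-R..R}" "(w - x) \<bullet> e1 \<in> {-R..R}"
    using assms(3,4) by (auto simp: abs_le_iff)
  then have "\<bar>\<psi> ((y - x) \<bullet> e1) - \<psi> ((w - x) \<bullet> e1)\<bar> \<le> M * \<bar>(y - x) \<bullet> e1 - (w - x) \<bullet> e1\<bar>"
    using assms(1) unfolding graph_chart_def by blast
  also have "\<dots> \<le> M * dist y w"
    using abs_inner_unit_le[OF e(1), of "y - w"] \<open>0 < M\<close>
    by (simp add: dist_norm inner_diff_left)
  finally have "\<bar>\<psi> ((y - x) \<bullet> e1) - \<psi> ((w - x) \<bullet> e1)\<bar> \<le> M * dist y w" .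
  moreover have "\<bar>(y - x) \<bullet> e2 - (w - x) \<bullet> e2\<bar> \<le> dist y w"
    using abs_inner_unit_le[OF e(2), of "y - w"] by (simp add: dist_norm inner_diff_left)
  ultimately show ?thesis
    by (simp add: algebra_simps)
qed

text \<open>This provides the measurability of \<open>\<Omega>\<close>. In the chart centred at a limit point \<open>x\<close>, points of \<open>\<Omega>\<close>
  arbitrarily close to \<open>x\<close> force \<open>0 \<le> \<psi> 0\<close>, which says that \<open>x\<close> belongs to \<open>\<Omega>\<close>.\<close>

lemma closed_if_graph_charts:
  assumes "0 < R" "0 < M" "\<Omega> \<subseteq> unit_square"
    and charts: "\<And>x. x \<in> unit_square \<Longrightarrow> \<exists>e1 e2 \<psi>. graph_chart R M \<Omega> x e1 e2 \<psi>"
  shows "closed \<Omega>"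
proof -
  have "x \<in> \<Omega>" if x: "x \<in> closure \<Omega>" for x
  proof -
    have "closed (unit_square)" by (simp add: unit_square_def closed_cbox)
    with x \<open>\<Omega> \<subseteq> unit_square\<close> have "x \<in> unit_square"
      by (meson closure_minimal subsetD)
    then obtain e1 e2 \<psi> where c: "graph_chart R M \<Omega> x e1 e2 \<psi>"
      using charts by blast
    have "0 \<le> \<psi> 0 + e" if "0 < e" for e
    proof -
      obtain y where y: "y \<in> \<Omega>" "dist y x < min R (e / (M + 1))"
        using x \<open>0 < e\<close> \<open>0 < R\<close> \<open>0 < M\<close> unfolding closure_approachable
        by (metis add_pos_pos divide_pos_pos min_less_iff_conj zero_less_one)
      then have "(M + 1) * dist y x \<le> e"
        using \<open>0 < M\<close> by (simp add: field_simps)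
      moreover have "(y - x) \<bullet> e2 \<le> \<psi> ((y - x) \<bullet> e1)"
        using y graph_chart_mem_iff[OF c, of y] by (simp add: dist_commute)
      ultimately show ?thesis
        using graph_chart_height_diff[OF c \<open>0 < M\<close>, of y x] y \<open>0 < R\<close> by (simp add: dist_commute)
    qed
    then have "0 \<le> \<psi> 0" by (rule field_le_epsilon)
    then show ?thesis
      using graph_chart_mem_iff[OF c, of x] \<open>0 < R\<close> by simp
  qed
  then show ?thesis
    by (metis closure_subset_eq subsetI)
qed

section \<open>The grid\<close>

lemma mem_cell_iff:
  fixes x :: "real^2"
  shows "x \<in> cbox (vector [a, b]) (vector [c, d]) \<longleftrightarrow> a \<le> x$1 \<and> x$1 \<le> c \<and> b \<le> x$2 \<and> x$2 \<le> d"
    and "x \<in> box (vector [a, b]) (vector [c, d]) \<longleftrightarrow> a < x$1 \<and> x$1 < c \<and> b < x$2 \<and> x$2 < d"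
  by (auto simp: mem_box_cart forall_2)

lemma gridE:
  assumes "T \<in> grid L"
  obtains i j where "i \<in> {1..L}" "j \<in> {1..L}"
    "T = cbox (vector [(real i - 1) * (1 / real L), (real j - 1) * (1 / real L)])
      (vector [real i * (1 / real L), real j * (1 / real L)])"
  using assms unfolding grid_def Let_def by blast

lemma finite_grid: "finite (grid L)"
proof (rule finite_subset)
  let ?f = "\<lambda>(i, j). cbox (vector [(real i - 1) * (1 / real L), (real j - 1) * (1 / real L)])
      (vector [real i * (1 / real L), real j * (1 / real L)]) :: (real^2) set"
  show "grid L \<subseteq> ?f ` ({1..L} \<times> {1..L})"
  proof
    fix T assume "T \<in> grid L"
    then obtain i j where "i \<in> {1..L}" "j \<in> {1..L}" "T = ?f (i, j)"
      by (elim gridE) simp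
    then show "T \<in> ?f ` ({1..L} \<times> {1..L})"
      by (intro image_eqI[where x = "(i, j)"]) simp_all
  qed
qed simp

lemma unit_interval_mesh:
  assumes "0 \<le> t" "t \<le> 1" "0 < L"
  obtains i where "i \<in> {1..L}" "(real i - 1) * (1 / real L) \<le> t" "t \<le> real i * (1 / real L)"
proof (cases "t = 0")
  case True
  then show ?thesis using that[of 1] \<open>0 < L\<close> by simp
next
  case False
  define i where "i = nat \<lceil>t * real L\<rceil>"
  have pos: "0 < t * real L" using False assms by simp
  have "real i = of_int \<lceil>t * real L\<rceil>" using pos unfolding i_def by simp
  then have i: "real i - 1 < t * real L" "t * real L \<le> real i" by linarith+
  have "t * real L \<le> real L" using assms by (simp add: mult_left_le_one_le)
  then have "i \<in> {1..L}"
    using pos unfolding i_def by (auto simp: nat_le_iff ceiling_le_iff Suc_le_eq)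
  then show ?thesis
    using that[of i] i \<open>0 < L\<close> by (simp add: field_simps)
qed

lemma unit_square_subset_grid:
  assumes "0 < L" "x \<in> unit_square"
  obtains T where "T \<in> grid L" "x \<in> T"
proof -
  have x: "0 \<le> x$1" "x$1 \<le> 1" "0 \<le> x$2" "x$2 \<le> 1"
    using assms(2) by (auto simp: unit_square_def mem_box_cart)
  obtain i where i: "i \<in> {1..L}" "(real i - 1) * (1 / real L) \<le> x$1" "x$1 \<le> real i * (1 / real L)"
    using unit_interval_mesh[OF x(1,2) assms(1)] .
  obtain j where j: "j \<in> {1..L}" "(real j - 1) * (1 / real L) \<le> x$2" "x$2 \<le> real j * (1 / real L)"
    using unit_interval_mesh[OF x(3,4) assms(1)] .
  show ?thesis
    using i j by (intro that[of "cbox (vector [(real i - 1) * (1 / real L), (real j - 1) * (1 / real L)])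
      (vector [real i * (1 / real L), real j * (1 / real L)])"])
      (unfold grid_def Let_def mem_cell_iff, blast+)
qed

lemma mesh_interval_unique:
  fixes i i' :: nat and h t :: real
  assumes "0 < h" "(real i - 1) * h < t" "t < real i * h" "(real i' - 1) * h \<le> t" "t \<le> real i' * h"
  shows "i = i'"
proof -
  have "(real i - 1) * h < real i' * h" "(real i' - 1) * h < real i * h"
    using assms(2-5) by linarith+
  then have "real i - 1 < real i'" "real i' - 1 < real i"
    using \<open>0 < h\<close> by simp_all
  then show ?thesis by linarith
qed

lemma grid_interior_unique:
  assumes "T \<in> grid L" "T' \<in> grid L" "x \<in> interior T" "x \<in> T'"
  shows "T' = T"
proof -
  let ?h = "1 / real L"
  from \<open>T \<in> grid L\<close> obtain i j where ij: "i \<in> {1..L}"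
    "T = cbox (vector [(real i - 1) * ?h, (real j - 1) * ?h]) (vector [real i * ?h, real j * ?h])"
    by (rule gridE)
  from \<open>T' \<in> grid L\<close> obtain i' j' where ij':
    "T' = cbox (vector [(real i' - 1) * ?h, (real j' - 1) * ?h]) (vector [real i' * ?h, real j' * ?h])"
    by (rule gridE)
  have h: "0 < ?h" using ij(1) by auto
  have "(real i - 1) * ?h < x$1 \<and> x$1 < real i * ?h \<and> (real j - 1) * ?h < x$2 \<and> x$2 < real j * ?h"
    using assms(3) unfolding ij interior_cbox mem_cell_iff .
  moreover have "(real i' - 1) * ?h \<le> x$1 \<and> x$1 \<le> real i' * ?h
      \<and> (real j' - 1) * ?h \<le> x$2 \<and> x$2 \<le> real j' * ?h"
    using assms(4) unfolding ij' mem_cell_iff .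
  ultimately have "i = i'" "j = j'"
    using mesh_interval_unique[OF h] by blast+
  then show ?thesis by (simp add: ij ij')
qed

lemma grid_cell_dist_le:
  assumes "T \<in> grid L" "x \<in> T" "y \<in> T"
  shows "dist x y \<le> 2 * (1 / real L)"
proof -
  let ?h = "1 / real L"
  from \<open>T \<in> grid L\<close> obtain i j where
    T: "T = cbox (vector [(real i - 1) * ?h, (real j - 1) * ?h]) (vector [real i * ?h, real j * ?h])"
    by (rule gridE)
  have "\<bar>(x - y)$1\<bar> \<le> ?h" "\<bar>(x - y)$2\<bar> \<le> ?h"
    using assms(2,3) unfolding T mem_cell_iff vector_minus_component left_diff_distrib by linarith+
  then show ?thesis
    using norm_le_l1_cart[of "x - y"] by (simp add: dist_norm sum_2)
qed

lemma grid_cell_measure_pos: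
  assumes "T \<in> grid L" "0 < L"
  shows "0 < measure lebesgue T"
proof -
  let ?h = "1 / real L"
  from \<open>T \<in> grid L\<close> obtain i j where
    T: "T = cbox (vector [(real i - 1) * ?h, (real j - 1) * ?h]) (vector [real i * ?h, real j * ?h])"
    by (rule gridE)
  have h: "0 < ?h" using \<open>0 < L\<close> by simp
  then have "vector [real i * ?h, real j * ?h] \<in> T"
    unfolding T mem_cell_iff by (simp add: divide_right_mono)
  then have "T \<noteq> {}" by blast
  then have "measure lebesgue T = ?h * ?h"
    unfolding T by (simp add: content_cbox_cart UNIV_2 left_diff_distrib diff_divide_distrib)
  with h show ?thesis by simp
qed

lemma grid_cell_lmeasurable: "T \<in> grid L \<Longrightarrow> T \<in> lmeasurable"
  by (erule gridE) simp

lemma grid_frontier_negligible: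
  "T \<in> grid L \<Longrightarrow> negligible (frontier T)"
  by (erule gridE) (simp add: negligible_convex_frontier convex_box)

section \<open>The pointwise error\<close>

lemma cell_average_indicator:
  assumes "T \<in> lmeasurable" "\<Omega> \<in> sets lebesgue"
  shows "cell_average (indicator \<Omega>) T = measure lebesgue (T \<inter> \<Omega>) / measure lebesgue T"
proof -
  have "(LINT x:T|lebesgue. indicator \<Omega> x) = (LINT x|lebesgue. indicator (T \<inter> \<Omega>) x :: real)"
    unfolding set_lebesgue_integral_def
    by (intro Bochner_Integration.integral_cong) (auto simp: indicator_def)
  then show ?thesis
    unfolding cell_average_def by simp
qed

text \<open>Neighbouring closed cells share edges, where several terms of the sum contribute; the interior
  of a cell meets no other cell.\<close>

lemma pc_approx_interior:
  assumes "T \<in> grid L" "x \<in> interior T"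
  shows "pc_approx L u x = cell_average u T"
proof -
  have "pc_approx L u x = (\<Sum>T'\<in>{T}. cell_average u T' * indicator T' x)"
    unfolding pc_approx_def
  proof (rule sum.mono_neutral_right[OF finite_grid])
    show "{T} \<subseteq> grid L" using assms(1) by simp
    show "\<forall>T'\<in>grid L - {T}. cell_average u T' * indicator T' x = 0"
      using grid_interior_unique[OF assms(1) _ assms(2)] by (auto simp: indicator_def)
  qed
  moreover have "x \<in> T"
    using assms(2) interior_subset by blast
  ultimately show ?thesis
    by simp
qed

lemma pc_approx_error_interior:
  assumes "0 < L" "\<Omega> \<in> sets lebesgue" "T \<in> grid L" "x \<in> interior T"
  shows "\<bar>indicator \<Omega> x - pc_approx L (indicator \<Omega>) x\<bar> \<le> 1"
    and "indicator \<Omega> x \<noteq> pc_approx L (indicator \<Omega>) x \<Longrightarrow> T \<inter> \<Omega> \<noteq> {} \<and> T - \<Omega> \<noteq> {}"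
proof -
  have T: "T \<in> lmeasurable" "0 < measure lebesgue T"
    using grid_cell_lmeasurable grid_cell_measure_pos assms by auto
  have pc: "pc_approx L (indicator \<Omega>) x = measure lebesgue (T \<inter> \<Omega>) / measure lebesgue T"
    using assms by (simp add: pc_approx_interior cell_average_indicator T(1))
  have "measure lebesgue (T \<inter> \<Omega>) \<le> measure lebesgue T"
    using T(1) assms(2) by (intro measure_mono_fmeasurable) auto
  then have "0 \<le> pc_approx L (indicator \<Omega>) x" "pc_approx L (indicator \<Omega>) x \<le> 1"
    unfolding pc using T(2) by simp_all
  then show "\<bar>indicator \<Omega> x - pc_approx L (indicator \<Omega>) x\<bar> \<le> 1"
    by (cases "x \<in> \<Omega>") auto
  have x: "x \<in> T" using assms(4) interior_subset[of T] by blast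
  assume ne: "indicator \<Omega> x \<noteq> pc_approx L (indicator \<Omega>) x"
  show "T \<inter> \<Omega> \<noteq> {} \<and> T - \<Omega> \<noteq> {}"
  proof (rule ccontr)
    assume "\<not> ?thesis"
    then consider "T \<inter> \<Omega> = {}" | "T \<subseteq> \<Omega>" by blast
    then show False
    proof cases
      case 1
      with x have "x \<notin> \<Omega>" by blast
      with 1 ne show False by (simp add: pc)
    next
      case 2
      then have "T \<inter> \<Omega> = T" by blast
      moreover have "x \<in> \<Omega>" using 2 x by blast
      ultimately show False using ne T(2) by (simp add: pc)
    qed
  qed
qed

section \<open>Covering the mixed cells\<close>

text \<open>Comparison with the circumscribed square of side \<open>2 * r\<close>.\<close>

lemma emeasure_cball_le:
  fixes c :: "real^2"
  assumes "0 \<le> r"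
  shows "emeasure lebesgue (cball c r) \<le> ennreal (4 * r\<^sup>2)"
proof -
  have sub: "cball c r \<subseteq> cbox (c - vec r) (c + vec r)"
  proof
    fix x assume "x \<in> cball c r"
    then have "norm (x - c) \<le> r" by (simp add: dist_norm norm_minus_commute)
    then have "\<bar>(x - c) $ i\<bar> \<le> r" for i
      using component_le_norm_cart order_trans by blast
    then show "x \<in> cbox (c - vec r) (c + vec r)"
      by (auto simp: mem_box_cart abs_le_iff algebra_simps)
  qed
  have "c \<in> cbox (c - vec r) (c + vec r)" using assms by (simp add: mem_box_cart)
  then have "measure lebesgue (cbox (c - vec r) (c + vec r)) = 4 * r\<^sup>2"
    by (subst measure_completion, simp, subst content_cbox_cart)
      (auto simp: UNIV_2 power2_eq_square)
  moreover have "emeasure lebesgue (cbox (c - vec r) (c + vec r))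
      = ennreal (measure lebesgue (cbox (c - vec r) (c + vec r)))"
    by (intro emeasure_eq_measure2) simp
  moreover have "emeasure lebesgue (cball c r) \<le> emeasure lebesgue (cbox (c - vec r) (c + vec r))"
    by (intro emeasure_mono sub) simp
  ultimately show ?thesis by simp
qed

text \<open>The function \<open>z2 - \<psi> z1\<close> is nonpositive at \<open>y\<close> and positive at \<open>z\<close>, so at the nearby point \<open>x\<close> it
  is at most \<open>2 * (M + 1) * h\<close> in absolute value. Replacing the first coordinate of \<open>x\<close> by the sample
  \<open>a\<close> costs another \<open>h\<close> horizontally and \<open>M * h\<close> vertically, in total \<open>3 * (M + 1) * h\<close>. The
  condition \<open>4 * h \<le> R\<close> keeps \<open>y\<close> and \<open>z\<close> within \<open>R / 4 + R / 2\<close> of the centre, where the chart applies.\<close>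

lemma graph_point_near_mixed_point:
  assumes c: "graph_chart R M \<Omega> x0 e1 e2 \<psi>" and "0 < R" "0 < M" "4 * h \<le> R"
    and x: "dist x0 x \<le> R / 4" and y: "y \<in> \<Omega>" "dist x y \<le> 2 * h"
    and z: "z \<notin> \<Omega>" "dist x z \<le> 2 * h"
    and a: "a \<in> {-R..R}" "\<bar>(x - x0) \<bullet> e1 - a\<bar> \<le> h"
  shows "x \<in> cball (x0 + a *\<^sub>R e1 + \<psi> a *\<^sub>R e2) (3 * (M + 1) * h)"
proof -
  let ?w1 = "(x - x0) \<bullet> e1" and ?w2 = "(x - x0) \<bullet> e2"
  have on: "orthonormal_system e1 e2" and e: "norm e1 = 1" "norm e2 = 1"
    using c by (auto simp: graph_chart_def orthonormal_system_def)
  have d: "dist x0 x \<le> R" "dist x0 y \<le> R" "dist x0 z \<le> R"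
    using x y(2) z(2) \<open>0 < R\<close> \<open>4 * h \<le> R\<close> dist_triangle[of x0 y x] dist_triangle[of x0 z x] by linarith+
  have "(M + 1) * dist x y \<le> (M + 1) * (2 * h)" "(M + 1) * dist x z \<le> (M + 1) * (2 * h)"
    using y z \<open>0 < M\<close> by (intro mult_left_mono; simp)+
  then have w: "\<bar>?w2 - \<psi> ?w1\<bar> \<le> (M + 1) * (2 * h)"
    using graph_chart_mem_iff[OF c d(2)] graph_chart_mem_iff[OF c d(3)] y(1) z(1)
      graph_chart_height_diff[OF c \<open>0 < M\<close> d(1,2)] graph_chart_height_diff[OF c \<open>0 < M\<close> d(1,3)]
    by linarith
  have "?w1 \<in> {-R..R}"
    using abs_inner_unit_le[OF e(1), of "x - x0"] d(1)
    by (auto simp: dist_norm norm_minus_commute abs_le_iff)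
  then have "\<bar>\<psi> ?w1 - \<psi> a\<bar> \<le> M * \<bar>?w1 - a\<bar>"
    using c a(1) unfolding graph_chart_def by blast
  also have "\<dots> \<le> M * h"
    using a(2) \<open>0 < M\<close> by simp
  finally have w2: "\<bar>?w2 - \<psi> a\<bar> \<le> (M + 1) * (2 * h) + M * h"
    using w by linarith
  have "x - (x0 + a *\<^sub>R e1 + \<psi> a *\<^sub>R e2) = (?w1 - a) *\<^sub>R e1 + (?w2 - \<psi> a) *\<^sub>R e2"
    using orthonormal_system_expand[OF on, of "x - x0"] by (simp add: algebra_simps)
  then have "dist x (x0 + a *\<^sub>R e1 + \<psi> a *\<^sub>R e2) \<le> \<bar>?w1 - a\<bar> + \<bar>?w2 - \<psi> a\<bar>"
    unfolding dist_norm using norm_triangle_ineq[of "(?w1 - a) *\<^sub>R e1" "(?w2 - \<psi> a) *\<^sub>R e2"] e by simp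
  also have "\<dots> \<le> h + ((M + 1) * (2 * h) + M * h)"
    using a(2) w2 by linarith
  also have "\<dots> = 3 * (M + 1) * h"
    by (simp add: algebra_simps)
  finally show ?thesis by (simp add: dist_commute)
qed

text \<open>The sampling of \<open>[-R, R]\<close> has \<open>L\<close> points and step \<open>2 * R * h < h\<close>. The balls around the samples
  on the graphs number \<open>card F * L\<close> and have area at most \<open>36 * (M + 1)\<^sup>2 * h\<^sup>2\<close> each, and \<open>L * h = 1\<close>.
  The two points \<open>y\<close> and \<open>z\<close> stand for the two sides of the boundary seen in one cell, whose
  diameter is below \<open>2 * h\<close>.\<close>

lemma mixed_points_cover:
  assumes "0 < R" "R < 1/2" "0 < M" "0 < L" "4 * (1 / real L) \<le> R"
    and F: "finite F" "unit_square \<subseteq> (\<Union>x\<in>F. ball x (R / 4))"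
    and charts: "\<And>x. x \<in> F \<Longrightarrow> \<exists>e1 e2 \<psi>. graph_chart R M \<Omega> x e1 e2 \<psi>"
  obtains B where "B \<in> sets lebesgue"
    "emeasure lebesgue B \<le> ennreal (real (card F) * (36 * (M + 1)\<^sup>2) * (1 / real L))"
    "\<And>x y z. x \<in> unit_square \<Longrightarrow> y \<in> \<Omega> \<Longrightarrow> z \<notin> \<Omega> \<Longrightarrow> dist x y \<le> 2 * (1 / real L) \<Longrightarrow>
      dist x z \<le> 2 * (1 / real L) \<Longrightarrow> x \<in> B"
proof -
  define h where "h = 1 / real L"
  have h: "0 < h" "real L * h = 1" "4 * h \<le> R"
    using assms(4,5) by (auto simp: h_def)
  obtain e1 e2 \<psi> where chart: "\<And>x. x \<in> F \<Longrightarrow> graph_chart R M \<Omega> x (e1 x) (e2 x) (\<psi> x)"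
    using charts by metis
  define a where "a i = - R + 2 * R * (real i * h)" for i :: nat
  define c where "c = (\<lambda>(x, i). x + a i *\<^sub>R e1 x + \<psi> x (a i) *\<^sub>R e2 x)"
  define B where "B = (\<Union>p\<in>F \<times> {1..L}. cball (c p) (3 * (M + 1) * h))"
  show ?thesis
  proof (rule that[of B, folded h_def])
    show "B \<in> sets lebesgue"
      unfolding B_def using F(1) by (intro sets.finite_UN) auto
    have "emeasure lebesgue B \<le> (\<Sum>p\<in>F \<times> {1..L}. emeasure lebesgue (cball (c p) (3 * (M + 1) * h)))"
      unfolding B_def using F(1) by (intro emeasure_subadditive_finite) auto
    also have "\<dots> \<le> (\<Sum>p\<in>F \<times> {1..L}. ennreal (4 * (3 * (M + 1) * h)\<^sup>2))"
      using h \<open>0 < M\<close> by (intro sum_mono emeasure_cball_le) simp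
    also have "\<dots> = ennreal (real (card (F \<times> {1..L})) * (4 * (3 * (M + 1) * h)\<^sup>2))"
      by (simp add: ennreal_mult ennreal_of_nat_eq_real_of_nat)
    also have "real (card (F \<times> {1..L})) * (4 * (3 * (M + 1) * h)\<^sup>2)
        = real (card F) * (36 * (M + 1)\<^sup>2) * h * (real L * h)"
      by (simp add: card_cartesian_product power2_eq_square algebra_simps)
    finally show "emeasure lebesgue B \<le> ennreal (real (card F) * (36 * (M + 1)\<^sup>2) * h)"
      by (simp add: h(2))
  next
    fix x y z assume x: "x \<in> unit_square" and yz: "y \<in> \<Omega>" "z \<notin> \<Omega>" "dist x y \<le> 2 * h" "dist x z \<le> 2 * h"
    obtain x0 where x0: "x0 \<in> F" "dist x0 x < R / 4"
      using x F(2) by auto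
    \<comment> \<open>The position of the first coordinate of \<open>x\<close> in \<open>[-R, R]\<close>, rescaled to the unit interval so
      that the next sample can be found by \<open>unit_interval_mesh\<close>.\<close>
    define t where "t = ((x - x0) \<bullet> e1 x0 + R) / (2 * R)"
    have "norm (e1 x0) = 1"
      using chart[OF x0(1)] by (simp add: graph_chart_def orthonormal_system_def)
    then have w: "\<bar>(x - x0) \<bullet> e1 x0\<bar> \<le> R"
      using abs_inner_unit_le[of "e1 x0" "x - x0"] x0(2) \<open>0 < R\<close> by (simp add: dist_norm norm_minus_commute)
    then have "0 \<le> t" "t \<le> 1"
      using \<open>0 < R\<close> by (auto simp: t_def divide_le_eq)
    from unit_interval_mesh[OF this \<open>0 < L\<close>, folded h_def]
    obtain i where i: "i \<in> {1..L}" "(real i - 1) * h \<le> t" "t \<le> real i * h" .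
    have "real i * h \<le> real L * h"
      using i(1) h(1) by simp
    then have ih: "0 \<le> real i * h" "real i * h \<le> 1"
      using h by simp_all
    have ai: "a i \<in> {-R..R}"
      using ih \<open>0 < R\<close> mult_left_mono[OF ih(2), of "2 * R"] by (simp add: a_def)
    have "(x - x0) \<bullet> e1 x0 = - R + 2 * R * t"
      using \<open>0 < R\<close> by (simp add: t_def field_simps)
    then have "(x - x0) \<bullet> e1 x0 - a i = 2 * R * (t - real i * h)"
      by (simp add: a_def algebra_simps)
    then have "\<bar>(x - x0) \<bullet> e1 x0 - a i\<bar> = 2 * R * \<bar>t - real i * h\<bar>"
      using \<open>0 < R\<close> by (simp add: abs_mult)
    also have "\<dots> \<le> 1 * h"
      using i(2,3) \<open>0 < R\<close> \<open>R < 1/2\<close> by (intro mult_mono) (auto simp: algebra_simps)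
    finally have "\<bar>(x - x0) \<bullet> e1 x0 - a i\<bar> \<le> h" by simp
    then have "x \<in> cball (c (x0, i)) (3 * (M + 1) * h)"
      unfolding c_def prod.case
      by (rule graph_point_near_mixed_point[OF chart[OF x0(1)] \<open>0 < R\<close> \<open>0 < M\<close> h(3)
          less_imp_le[OF x0(2)] yz(1,3,2,4) ai])
    then show "x \<in> B"
      unfolding B_def using x0(1) i(1) by blast
  qed
qed

section \<open>From the measure of the error set to the norm\<close>

text \<open>The assumption \<open>1 \<le> C\<close> serves twice: it bounds the supremum when \<open>q = \<infinity>\<close>, and it lets
  \<open>C powr (1 / q) \<le> C\<close> remove the dependence of the constant on \<open>q\<close>.\<close>

lemma Lq_norm_le_of_small_support:
  assumes f: "f \<in> borel_measurable \<mu>" and B: "B \<in> sets \<mu>"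
    and le: "AE x in \<mu>. \<bar>f x\<bar> \<le> indicator B x"
    and \<mu>B: "emeasure \<mu> B \<le> ennreal (C * h)" and "1 \<le> C" "0 < h" "1 \<le> q"
  shows "Lq_norm q \<mu> f \<le> ennreal (C * h powr enn2real (1 / q))"
proof (cases "q = \<infinity>")
  case True
  have "esssup \<mu> (\<lambda>x. ennreal \<bar>f x\<bar>) \<le> ennreal C"
  proof (rule esssup_I)
    show "(\<lambda>x. ennreal \<bar>f x\<bar>) \<in> borel_measurable \<mu>" using f by measurable
    show "AE x in \<mu>. ennreal \<bar>f x\<bar> \<le> ennreal C"
      using le
    proof eventually_elim
      case (elim x)
      also have "indicator B x \<le> C" using \<open>1 \<le> C\<close> by (simp add: indicator_def)
      finally show ?case by (rule ennreal_leI)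
    qed
  qed
  then show ?thesis
    using True \<open>0 < h\<close> by (simp add: Lq_norm_def)
next
  case False
  then obtain r where r: "q = ennreal r" "0 \<le> r"
    by (cases q) auto
  with \<open>1 \<le> q\<close> have "1 \<le> r" by simp
  have q: "enn2real q = r" "enn2real (1 / q) = 1 / r"
    using \<open>1 \<le> r\<close> by (simp_all add: r(1) divide_ennreal flip: ennreal_1)
  define I where "I = (\<integral>\<^sup>+x. ennreal (\<bar>f x\<bar> powr r) \<partial>\<mu>)"
  have "I \<le> (\<integral>\<^sup>+x. indicator B x \<partial>\<mu>)"
    unfolding I_def
  proof (rule nn_integral_mono_AE)
    show "AE x in \<mu>. ennreal (\<bar>f x\<bar> powr r) \<le> indicator B x"
      using le
    proof eventually_elim
      case (elim x)
      show ?case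
      proof (cases "x \<in> B")
        case True
        then have "\<bar>f x\<bar> powr r \<le> 1"
          using elim \<open>1 \<le> r\<close> by (intro powr_le1) auto
        with True show ?thesis by simp
      next
        case False
        then show ?thesis using elim by simp
      qed
    qed
  qed
  also have "\<dots> \<le> ennreal (C * h)"
    using B \<mu>B by simp
  finally have I: "I \<le> ennreal (C * h)" .
  then have "I \<noteq> \<infinity>" by (auto simp: top_unique)
  have "enn2real I \<le> C * h"
    using enn2real_mono[OF I] \<open>1 \<le> C\<close> \<open>0 < h\<close> by simp
  then have "enn2real I powr (1 / r) \<le> (C * h) powr (1 / r)"
    using \<open>1 \<le> r\<close> by (intro powr_mono2) auto
  also have "\<dots> = C powr (1 / r) * h powr (1 / r)"
    using \<open>1 \<le> C\<close> \<open>0 < h\<close> by (simp add: powr_mult)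
  also have "\<dots> \<le> C * h powr (1 / r)"
    using \<open>1 \<le> C\<close> \<open>1 \<le> r\<close> powr_mono[of "1 / r" 1 C] by (intro mult_right_mono) auto
  finally show ?thesis
    using False f \<open>I \<noteq> \<infinity>\<close> unfolding Lq_norm_def q I_def Let_def by (simp add: ennreal_leI)
qed

lemma powr_cell_count:
  assumes "0 < h" "1 \<le> q"
  shows "h powr enn2real (1 / q) = (h powi (-2)) powr (- enn2real (1 / (2 * q)))"
proof (cases "q = \<infinity>")
  case True
  then show ?thesis using assms(1) by simp
next
  case False
  then obtain r where r: "q = ennreal r" "0 \<le> r"
    by (cases q) auto
  with \<open>1 \<le> q\<close> have "1 \<le> r" by simp
  have "2 * q = ennreal (2 * r)"
    using r by (simp add: ennreal_mult)
  then have q: "enn2real (1 / q) = 1 / r" "enn2real (1 / (2 * q)) = 1 / (2 * r)"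
    using \<open>1 \<le> r\<close> by (simp_all add: r(1) divide_ennreal flip: ennreal_1)
  have "h powi (-2) = h powr (-2)"
    using assms(1) powr_real_of_int'[of h "-2"] by simp
  then show ?thesis
    unfolding q by (simp add: powr_powr)
qed

lemma unit_square_lmeasurable: "unit_square \<in> lmeasurable"
  by (simp add: unit_square_def)

lemma emeasure_unit_square: "emeasure lebesgue unit_square = 1"
proof -
  have "0 \<in> (cbox 0 1 :: (real^2) set)" by (simp add: mem_box_cart)
  then have "measure lebesgue (cbox 0 1 :: (real^2) set) = 1"
    by (subst measure_completion, simp, subst content_cbox_cart) auto
  then show ?thesis
    unfolding unit_square_def
    by (subst emeasure_eq_measure2) (auto intro: fmeasurable_cbox)
qed

text \<open>The exceptional null set is the union of the cell edges.\<close>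

lemma pc_approx_error_AE:
  assumes "0 < L" "\<Omega> \<in> sets lebesgue"
    and B: "\<And>x y z. x \<in> unit_square \<Longrightarrow> y \<in> \<Omega> \<Longrightarrow> z \<notin> \<Omega> \<Longrightarrow> dist x y \<le> 2 * (1 / real L) \<Longrightarrow>
      dist x z \<le> 2 * (1 / real L) \<Longrightarrow> x \<in> B"
  shows "AE x in lebesgue_on unit_square.
    \<bar>indicator \<Omega> x - pc_approx L (indicator \<Omega>) x\<bar> \<le> indicator (B \<inter> unit_square) x"
proof -
  have "AE x in lebesgue. \<forall>T\<in>grid L. x \<notin> frontier T"
    using grid_frontier_negligible
    by (intro AE_finite_allI finite_grid AE_not_in) (simp add: negligible_iff_null_sets)
  then have "AE x in lebesgue. x \<in> unit_square \<longrightarrow>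
    \<bar>indicator \<Omega> x - pc_approx L (indicator \<Omega>) x\<bar> \<le> indicator (B \<inter> unit_square) x"
  proof eventually_elim
    case (elim x)
    show ?case
    proof
      assume x: "x \<in> unit_square"
      obtain T where T: "T \<in> grid L" "x \<in> T"
        using unit_square_subset_grid[OF \<open>0 < L\<close> x] .
      with elim have int: "x \<in> interior T"
        using closure_subset by (auto simp: frontier_def)
      note err = pc_approx_error_interior[OF \<open>0 < L\<close> \<open>\<Omega> \<in> sets lebesgue\<close> T(1) int]
      show "\<bar>indicator \<Omega> x - pc_approx L (indicator \<Omega>) x\<bar> \<le> indicator (B \<inter> unit_square) x"
      proof (cases "indicator \<Omega> x = pc_approx L (indicator \<Omega>) x")
        case False
        then obtain y z where "y \<in> T \<inter> \<Omega>" "z \<in> T - \<Omega>"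
          using err(2) by blast
        then have "x \<in> B"
          using B[OF x, of y z] grid_cell_dist_le[OF T] by blast
        with x err(1) show ?thesis by simp
      qed simp
    qed
  qed
  then show ?thesis
    using unit_square_lmeasurable by (subst AE_restrict_space_iff) auto
qed

lemma pc_approx_error_measurable:
  assumes "\<Omega> \<in> sets lebesgue"
  shows "(\<lambda>x. indicator \<Omega> x - pc_approx L (indicator \<Omega>) x) \<in> borel_measurable (lebesgue_on S)"
proof -
  have "T \<in> sets lebesgue" if "T \<in> grid L" for T
    using grid_cell_lmeasurable[OF that] by blast
  with assms show ?thesis
    unfolding pc_approx_def
    by (intro measurable_restrict_space1 borel_measurable_diff borel_measurable_sum
        borel_measurable_times borel_measurable_const borel_measurable_indicator)
qed

theorem proposition4p3:
  fixes R M :: real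
  assumes "0 < R" and "R < 1/2" and "0 < M"
  shows "\<exists>C>0. \<forall>(s::real) (q::ennreal) (L::nat) (\<Omega>::(real^2) set).
    s \<ge> 1 \<longrightarrow> 1 \<le> q \<longrightarrow> L > 1 \<longrightarrow> indicator \<Omega> \<in> char_class s R M \<longrightarrow>
    (let h = 1 / real L; n = h powi (-2) in
      Lq_norm q (lebesgue_on unit_square)
        (\<lambda>x. indicator \<Omega> x - pc_approx L (indicator \<Omega>) x) \<le> ennreal (C * h powr enn2real (1 / q))
      \<and> C * h powr enn2real (1 / q) = C * n powr (- enn2real (1 / (2 * q))))"
proof -
  obtain F where F: "F \<subseteq> unit_square" "finite F" "unit_square \<subseteq> (\<Union>x\<in>F. ball x (R / 4))"
  proof (rule compactE_image[of unit_square unit_square "\<lambda>x. ball x (R / 4)"])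
    show "compact unit_square" by (simp add: unit_square_def compact_cbox)
    show "unit_square \<subseteq> (\<Union>x\<in>unit_square. ball x (R / 4))"
      using \<open>0 < R\<close> by (auto intro!: bexI)
  qed auto
  define K where "K = real (card F) * (36 * (M + 1)\<^sup>2)"
  \<comment> \<open>\<open>4 / R\<close> handles the coarse grids with \<open>4 * h > R\<close>, \<open>K\<close> the others.\<close>
  define C where "C = max 1 (max (4 / R) K)"
  have C: "1 \<le> C" "4 / R \<le> C" "K \<le> C"
    by (auto simp: C_def)
  show ?thesis
  proof (intro exI[of _ C] conjI allI impI)
    show "0 < C" using C(1) by simp
    fix s :: real and q :: ennreal and L :: nat and \<Omega> :: "(real^2) set"
    assume "1 \<le> s" "1 \<le> q" "1 < L" and \<Omega>: "indicator \<Omega> \<in> char_class s R M"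
    let ?h = "1 / real L"
    have h: "0 < ?h" "0 < L" using \<open>1 < L\<close> by auto
    note charts = char_class_graph_chart[OF \<open>1 \<le> s\<close> \<open>0 < R\<close> \<open>0 < M\<close> \<Omega>]
    have "closed \<Omega>"
      by (rule closed_if_graph_charts[OF \<open>0 < R\<close> \<open>0 < M\<close> charts])
    then have \<Omega>_sets: "\<Omega> \<in> sets lebesgue" by (simp add: borel_closed)
    obtain B where B: "B \<in> sets lebesgue" "emeasure lebesgue B \<le> ennreal (C * ?h)"
      "\<And>x y z. x \<in> unit_square \<Longrightarrow> y \<in> \<Omega> \<Longrightarrow> z \<notin> \<Omega> \<Longrightarrow> dist x y \<le> 2 * ?h \<Longrightarrow>
        dist x z \<le> 2 * ?h \<Longrightarrow> x \<in> B"
    proof (cases "4 * ?h \<le> R")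
      case True
      obtain B where "B \<in> sets lebesgue" "emeasure lebesgue B \<le> ennreal (K * ?h)"
        "\<And>x y z. x \<in> unit_square \<Longrightarrow> y \<in> \<Omega> \<Longrightarrow> z \<notin> \<Omega> \<Longrightarrow> dist x y \<le> 2 * ?h \<Longrightarrow>
          dist x z \<le> 2 * ?h \<Longrightarrow> x \<in> B"
        using mixed_points_cover[OF \<open>0 < R\<close> \<open>R < 1/2\<close> \<open>0 < M\<close> h(2) True F(2,3) charts(2), folded K_def]
          F(1) by blast
      moreover have "ennreal (K * ?h) \<le> ennreal (C * ?h)"
        using C(3) h(1) by (intro ennreal_leI mult_right_mono) auto
      ultimately show ?thesis using that[of B] by (meson order_trans)
    next
      case False
      then have "1 \<le> 4 / R * ?h"
        using \<open>0 < R\<close> h(2) by (simp add: not_le field_simps)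
      also have "\<dots> \<le> C * ?h"
        using C(2) h(1) by (intro mult_right_mono) auto
      finally have "emeasure lebesgue unit_square \<le> ennreal (C * ?h)"
        unfolding emeasure_unit_square by simp
      then show ?thesis
        using unit_square_lmeasurable by (intro that[of unit_square]) auto
    qed
    have "Lq_norm q (lebesgue_on unit_square)
        (\<lambda>x. indicator \<Omega> x - pc_approx L (indicator \<Omega>) x) \<le> ennreal (C * ?h powr enn2real (1 / q))"
    proof (rule Lq_norm_le_of_small_support[OF pc_approx_error_measurable[OF \<Omega>_sets] _
          pc_approx_error_AE[OF h(2) \<Omega>_sets B(3)] _ C(1) h(1) \<open>1 \<le> q\<close>])
      show "B \<inter> unit_square \<in> sets (lebesgue_on unit_square)"
        using B(1) unit_square_lmeasurable by (subst sets_restrict_space_iff) auto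
      have "emeasure (lebesgue_on unit_square) (B \<inter> unit_square) = emeasure lebesgue (B \<inter> unit_square)"
        using unit_square_lmeasurable by (intro emeasure_restrict_space) auto
      also have "\<dots> \<le> emeasure lebesgue B"
        using B(1) by (intro emeasure_mono) auto
      finally show "emeasure (lebesgue_on unit_square) (B \<inter> unit_square) \<le> ennreal (C * ?h)"
        using B(2) by order
    qed
    then show "let h = 1 / real L; n = h powi (-2) in
      Lq_norm q (lebesgue_on unit_square)
        (\<lambda>x. indicator \<Omega> x - pc_approx L (indicator \<Omega>) x) \<le> ennreal (C * h powr enn2real (1 / q))
      \<and> C * h powr enn2real (1 / q) = C * n powr (- enn2real (1 / (2 * q)))"
      unfolding Let_def using powr_cell_count[OF h(1) \<open>1 \<le> q\<close>] by simp
  qed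
qed

end
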